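(* Let $R\colon(0,T]\to L(H)$ be strongly continuous, let $\Phi\colon\Omega_T\to L(U,H)$ be a function, and define $$\Phi_R\colon\Omega_T\times[0,T]\to L(U,H),\quad \Phi_R((\omega,s),t):=\mathbf{1}_{[0,t)}(s)R(t-s)\Phi_s(\omega).$$ (i) If $\Phi$ is strongly measurable and if $\mathbf{1}_{[0,t)}(s)R(t-s)\Phi_s(\omega)\in L_2(U,H)$ for all $((\omega,s),t)\in\Omega_T\times[0,T]$, then $\Phi_R$ is measurable as an $L_2(U,H)$-valued map (that is, $\mathcal{P}_T\otimes\mathcal{B}_T/\mathcal{B}_{L_2(U,H)}$-measurable, where $\mathcal{B}_{L_2(U,H)}$ is the Borel $\sigma$-algebra of $L_2(U,H)$). (ii) Suppose that there exists a sequence $\{t_n\}_{n\in\mathbb{N}}\subset(0,T]$ converging to $0$ such that, for every closed, convex and bounded set $C\subset H$ and every $u\in H$, one has $u\in C$ if and only if there exists $k\in\mathbb{N}$ such that $R(t_n)u\in R(t_n)C$ for all $n\ge k$. If $\Phi_R$ has values in $L_2(U,H)$ and is measurable as an $L_2(U,H)$-valued map, then there exist $\hat\Phi\colon\Omega_T\to L(U,H)$ and a $\mathbb{P}\otimes m$-null set $A\in\mathcal{P}_T$ such that $\Phi=\hat\Phi$ on $\Omega_T\setminus A$, $\hat\Phi$ is strongly measurable, and $\mathbf{1}_{[0,t)}(s)R(t-s)\hat\Phi_s(\omega)\in L_2(U,H)$ for all $((\omega,s),t)\in\Omega_T\times[0,T]$.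
   Context: $T>0$, $\mathcal{B}_T$ is the Borel $\sigma$-algebra of $[0,T]$, $m$ is Lebesgue measure, $(\Omega,\mathcal{F},\mathbb{F}=\{\mathcal{F}_t\}_{t\in[0,T]},\mathbb{P})$ is a complete filtered probability space, $\Omega_T:=\Omega\times[0,T]$, and $\mathcal{P}_T$ is the predictable $\sigma$-algebra on $\Omega_T$ associated with $\mathbb{F}$. $H$ and $U$ are separable Hilbert spaces, $L(U,H)$ (resp. $L(H)$) is the space of bounded linear operators from $U$ to $H$ (resp. from $H$ to $H$), and $L_2(U,H)$ is the space of Hilbert-Schmidt operators from $U$ to $H$. The expression $\mathbf{1}_{[0,t)}(s)R(t-s)\Phi_s(\omega)$ is understood to be $0$ when $s\ge t$. $R$ strongly continuous means that $t\mapsto R(t)h$ is continuous on $(0,T]$ for every $h\in H$. A function $\Phi\colon\Omega_T\to L(U,H)$ is called strongly measurable if $(\Omega_T,\mathcal{P}_T)\to H$, $(\omega,t)\mapsto\Phi_t(\omega)u$, is (Borel) measurable for all $u\in U$. *)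

theory Defs
  imports "HOL-Probability.Probability"
begin

section \<open>Hilbert-Schmidt operators\<close>

definition orthonormal :: "'a::real_inner set \<Rightarrow> bool" where
  "orthonormal B \<longleftrightarrow> pairwise orthogonal B \<and> (\<forall>e\<in>B. norm e = 1)"

definition orthonormal_basis :: "'a::real_inner set \<Rightarrow> bool" where
  "orthonormal_basis B \<longleftrightarrow> orthonormal B \<and> closure (span B) = UNIV"

text \<open>On separable Hilbert spaces neither the Hilbert-Schmidt property nor the norm depends on
  the choice of the orthonormal basis: see \<open>hs_norm_has_sum\<close> below.\<close>

definition hilbert_schmidt :: "('u::real_inner \<Rightarrow>\<^sub>L 'h::real_inner) \<Rightarrow> bool" where
  "hilbert_schmidt S \<longleftrightarrow>
     (\<exists>B. orthonormal_basis B \<and> (\<lambda>e. (norm (blinfun_apply S e))\<^sup>2) summable_on B)"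

definition hs_norm :: "('u::real_inner \<Rightarrow>\<^sub>L 'h::real_inner) \<Rightarrow> real" where
  "hs_norm S =
     sqrt (\<Sum>\<^sub>\<infinity>e\<in>(SOME B. orthonormal_basis B). (norm (blinfun_apply S e))\<^sup>2)"

definition hs_ops :: "('u::real_inner \<Rightarrow>\<^sub>L 'h::real_inner) set" where
  "hs_ops = {S. hilbert_schmidt S}"

definition hs_dist :: "('u::real_inner \<Rightarrow>\<^sub>L 'h::real_inner) \<Rightarrow> ('u \<Rightarrow>\<^sub>L 'h) \<Rightarrow> real" where
  "hs_dist S S' = hs_norm (S - S')"

lemma orthonormal_finite_sum:
  assumes B: "orthonormal B" and F: "finite F" "F \<subseteq> B"
  shows "(norm (\<Sum>b\<in>F. c b *\<^sub>R b))\<^sup>2 = (\<Sum>b\<in>F. (c b)\<^sup>2)"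
proof -
  have o: "b \<bullet> b' = (if b = b' then 1 else 0)" if "b \<in> F" "b' \<in> F" for b b'
  proof (cases "b = b'")
    case True
    have "norm b = 1" using that B F unfolding orthonormal_def by auto
    then show ?thesis using True by (simp add: norm_eq_1)
  next
    case False
    then have "orthogonal b b'" using that B F unfolding orthonormal_def pairwise_def by blast
    then show ?thesis using False by (simp add: orthogonal_def)
  qed
  have "(norm (\<Sum>b\<in>F. c b *\<^sub>R b))\<^sup>2 = (\<Sum>b\<in>F. \<Sum>b'\<in>F. c b * (c b' * (b \<bullet> b')))"
    unfolding power2_norm_eq_inner by (simp add: inner_sum_left inner_sum_right sum_distrib_left inner_commute mult.left_commute)
  also have "\<dots> = (\<Sum>b\<in>F. \<Sum>b'\<in>F. if b = b' then c b * c b' else 0)"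
    by (intro sum.cong refl) (auto simp: o)
  also have "\<dots> = (\<Sum>b\<in>F. (c b)\<^sup>2)"
    using F(1) by (simp add: power2_eq_square sum.delta)
  finally show ?thesis .
qed

lemma orthonormal_extend:
  assumes B: "orthonormal B" "finite B"
  shows "\<exists>B'. finite B' \<and> orthonormal B' \<and> B \<subseteq> B' \<and> x \<in> span B'"
proof -
  define y where "y = x - (\<Sum>b\<in>B. (x \<bullet> b) *\<^sub>R b)"
  have s: "(\<Sum>b\<in>B. (x \<bullet> b) *\<^sub>R b) \<in> span B"
    by (intro span_sum span_scale span_base)
  have yo: "y \<bullet> b = 0" if "b \<in> B" for b
  proof -
    have "(\<Sum>b'\<in>B. (x \<bullet> b') * (b' \<bullet> b)) = (\<Sum>b'\<in>B. if b' = b then x \<bullet> b' else 0)"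
    proof (intro sum.cong refl)
      fix b' assume "b' \<in> B"
      then show "(x \<bullet> b') * (b' \<bullet> b) = (if b' = b then x \<bullet> b' else 0)"
        using that B(1) unfolding orthonormal_def pairwise_def orthogonal_def 
        by (auto simp: norm_eq_1)
    qed
    then show ?thesis using that B(2) by (simp add: y_def inner_diff_left inner_sum_left)
  qed
  show ?thesis
  proof (cases "y = 0")
    case True
    then show ?thesis using B s by (intro exI[of _ B]) (auto simp: y_def)
  next
    case False
    define z where "z = y /\<^sub>R norm y"
    have nz: "norm z = 1" using False by (simp add: z_def)
    have zo: "z \<bullet> b = 0" "b \<bullet> z = 0" if "b \<in> B" for b using yo[OF that] by (auto simp: z_def inner_commute)
    have "y = norm y *\<^sub>R z" using False by (simp add: z_def)
    then have "y \<in> span (insert z B)" by (metis insertI1 span_base span_scale)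
    moreover have "x = y + (\<Sum>b\<in>B. (x \<bullet> b) *\<^sub>R b)" by (simp add: y_def)
    moreover have "(\<Sum>b\<in>B. (x \<bullet> b) *\<^sub>R b) \<in> span (insert z B)"
      using s span_mono[of B "insert z B"] by blast
    ultimately have "x \<in> span (insert z B)" using span_add by metis
    moreover have "orthonormal (insert z B)"
      using B(1) nz zo unfolding orthonormal_def pairwise_insert orthogonal_def by auto
    ultimately show ?thesis using B(2) by (intro exI[of _ "insert z B"]) auto
  qed
qed

lemma orthonormal_basis_exists:
  "\<exists>B::'a::{real_inner, second_countable_topology} set. orthonormal_basis B"
proof -
  obtain D :: "'a set" where D: "countable D" "\<And>X. open X \<Longrightarrow> X \<noteq> {} \<Longrightarrow> \<exists>d\<in>D. d \<in> X"
    using countable_dense_setE by blast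
  have "D \<noteq> {}" using D(2)[of UNIV] by auto
  define d where "d = from_nat_into D"
  have rd: "range d = D" using D(1) \<open>D \<noteq> {}\<close> by (simp add: d_def range_from_nat_into)
  have "\<exists>f. \<forall>n. (finite (f n) \<and> orthonormal (f n)) \<and> (f n \<subseteq> f (Suc n) \<and> d n \<in> span (f (Suc n)))"
  proof (rule dependent_nat_choice)
    show "\<exists>B::'a set. finite B \<and> orthonormal B"
      by (rule exI[of _ "{}"]) (auto simp: orthonormal_def)
    show "\<exists>B'. (finite B' \<and> orthonormal B') \<and> (B \<subseteq> B' \<and> d n \<in> span B')"
      if "finite B \<and> orthonormal B" for B n
      using orthonormal_extend[of B "d n"] that by blast
  qed
  then obtain f where f: "\<And>n. orthonormal (f n)" "\<And>n. f n \<subseteq> f (Suc n)" "\<And>n. d n \<in> span (f (Suc n))"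
    by blast
  define B where "B = (\<Union>n. f n)"
  have m: "f i \<subseteq> f j" if "i \<le> j" for i j using f(2) that by (rule lift_Suc_mono_le)
  have "orthonormal B"
    unfolding orthonormal_def
  proof
    show "pairwise orthogonal B"
    proof (rule pairwiseI)
      fix x y assume "x \<in> B" "y \<in> B" "x \<noteq> y"
      then obtain i j where "x \<in> f i" "y \<in> f j" by (auto simp: B_def)
      then have "x \<in> f (max i j)" "y \<in> f (max i j)" using m[of i "max i j"] m[of j "max i j"] by auto
      then show "orthogonal x y" using f(1) \<open>x \<noteq> y\<close> unfolding orthonormal_def pairwise_def by blast
    qed
    show "\<forall>e\<in>B. norm e = 1" using f(1) by (auto simp: B_def orthonormal_def)
  qed
  moreover have "closure (span B) = UNIV"
  proof -
    have "D \<subseteq> span B"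
    proof
      fix x assume "x \<in> D"
      then obtain n where "x = d n" using rd by blast
      then show "x \<in> span B" using f(3)[of n] span_mono[of "f (Suc n)" B] by (auto simp: B_def)
    qed
    moreover have "x \<in> closure D" for x
      unfolding closure_iff_nhds_not_empty using D(2) by (metis disjoint_iff empty_iff subset_iff)
    ultimately show ?thesis using closure_mono by blast
  qed
  ultimately show ?thesis unfolding orthonormal_basis_def by blast
qed

lemma functional_has_sum:
  fixes \<phi> :: "'a::real_inner \<Rightarrow>\<^sub>L real"
  assumes B: "orthonormal_basis B"
  shows "((\<lambda>b. (\<phi> b)\<^sup>2) has_sum (norm \<phi>)\<^sup>2) B"
proof -
  have on: "orthonormal B" and dense: "closure (span B) = UNIV"
    using B by (auto simp: orthonormal_basis_def)
  have fin: "(\<Sum>b\<in>F. (\<phi> b)\<^sup>2) \<le> (norm \<phi>)\<^sup>2" if F: "finite F" "F \<subseteq> B" for F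
  proof -
    define x where "x = (\<Sum>b\<in>F. \<phi> b *\<^sub>R b)"
    define q where "q = (\<Sum>b\<in>F. (\<phi> b)\<^sup>2)"
    have nx: "(norm x)\<^sup>2 = q" unfolding x_def q_def by (rule orthonormal_finite_sum[OF on F])
    have "\<phi> x = q" by (simp add: x_def q_def blinfun.sum_right blinfun.scaleR_right power2_eq_square)
    then have "(norm x)\<^sup>2 \<le> norm \<phi> * norm x" using norm_blinfun[of \<phi> x] nx by simp
    then have "norm x \<le> norm \<phi>"
      by (cases "norm x = 0") (auto simp: power2_eq_square)
    then show ?thesis using nx q_def by (metis norm_ge_zero power_mono)
  qed
  have bdd: "bdd_above (sum (\<lambda>b. (\<phi> b)\<^sup>2) ` {F. F \<subseteq> B \<and> finite F})"
    using fin by (auto intro!: bdd_aboveI[of _ "(norm \<phi>)\<^sup>2"])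
  have summ: "(\<lambda>b. (\<phi> b)\<^sup>2) summable_on B"
    by (rule nonneg_bdd_above_summable_on[OF _ bdd]) simp
  define s where "s = (\<Sum>\<^sub>\<infinity>b\<in>B. (\<phi> b)\<^sup>2)"
  have s0: "s \<ge> 0" unfolding s_def by (rule infsum_nonneg) simp
  have le: "s \<le> (norm \<phi>)\<^sup>2"
    unfolding s_def by (rule infsum_le_finite_sums[OF summ]) (use fin in auto)
  have sp: "norm (\<phi> x) \<le> sqrt s * norm x" if x: "x \<in> span B" for x
  proof -
    obtain F c where F: "finite F" "F \<subseteq> B" and xe: "x = (\<Sum>b\<in>F. c b *\<^sub>R b)"
      using x unfolding span_explicit by auto
    have "\<bar>\<phi> x\<bar> = \<bar>\<Sum>b\<in>F. c b * \<phi> b\<bar>"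
      by (simp add: xe blinfun.sum_right blinfun.scaleR_right)
    also have "\<dots> \<le> (\<Sum>b\<in>F. \<bar>c b\<bar> * \<bar>\<phi> b\<bar>)"
      by (metis (no_types, lifting) abs_mult sum.cong sum_abs)
    also have "\<dots> \<le> L2_set c F * L2_set (\<lambda>b. \<phi> b) F"
      by (rule L2_set_mult_ineq)
    also have "L2_set c F = norm x"
      unfolding L2_set_def xe orthonormal_finite_sum[OF on F, symmetric] by simp
    also have "L2_set (\<lambda>b. \<phi> b) F \<le> sqrt s"
      unfolding L2_set_def s_def
      by (intro real_sqrt_le_mono finite_sum_le_infsum summ F) auto
    finally have "\<bar>\<phi> x\<bar> \<le> norm x * sqrt s" by (simp add: mult_left_mono)
    then show ?thesis by (simp add: mult.commute)
  qed
  have "norm (\<phi> x) \<le> sqrt s * norm x" for x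
  proof -
    have "x \<in> closure (span B)" by (simp add: dense)
    moreover have "closed {x. norm (\<phi> x) \<le> sqrt s * norm x}"
      by (intro closed_Collect_le continuous_intros)
    ultimately show ?thesis using sp closure_minimal[of "span B" "{x. norm (\<phi> x) \<le> sqrt s * norm x}"] by blast
  qed
  then have "norm \<phi> \<le> sqrt s" using s0 by (intro norm_blinfun_bound) auto
  then have "(norm \<phi>)\<^sup>2 \<le> s" using s0 by (metis norm_ge_zero power_mono real_sqrt_pow2)
  then have "s = (norm \<phi>)\<^sup>2" using le by simp
  then show ?thesis using summ s_def by (metis has_sum_infsum)
qed

lemma parseval_has_sum:
  assumes B: "orthonormal_basis B"
  shows "((\<lambda>b. (y \<bullet> b)\<^sup>2) has_sum (norm y)\<^sup>2) B"
proof -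
  have "norm (blinfun_inner_right y) = norm y"
  proof (rule antisym)
    show "norm (blinfun_inner_right y) \<le> norm y"
      by (rule norm_blinfun_bound) (auto simp: Cauchy_Schwarz_ineq2)
    have "norm y * norm y \<le> norm (blinfun_inner_right y) * norm y"
      using norm_blinfun[of "blinfun_inner_right y" y] by (simp add: dot_square_norm power2_eq_square)
    then show "norm y \<le> norm (blinfun_inner_right y)"
      by (cases "norm y = 0") auto
  qed
  then show ?thesis using functional_has_sum[OF B, of "blinfun_inner_right y"] by simp
qed

lemma hs_sum_dual:
  fixes S :: "'u::real_inner \<Rightarrow>\<^sub>L 'h::real_inner"
  assumes B: "orthonormal_basis B" and D: "orthonormal_basis D"
    and summ: "(\<lambda>e. (norm (S e))\<^sup>2) summable_on B"
  shows "((\<lambda>d. (norm (blinfun_inner_right d o\<^sub>L S))\<^sup>2) has_sum (\<Sum>\<^sub>\<infinity>e\<in>B. (norm (S e))\<^sup>2)) D"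
proof -
  let ?f = "\<lambda>(e,d). (S e \<bullet> d)\<^sup>2"
  have "(?f has_sum (\<Sum>\<^sub>\<infinity>e\<in>B. (norm (S e))\<^sup>2)) (B \<times> D)"
    by (rule has_sum_SigmaI[where g = "\<lambda>e. (norm (S e))\<^sup>2"])
       (use parseval_has_sum[OF D] summ in
         \<open>auto intro!: summable_on_SigmaI[where g = "\<lambda>e. (norm (S e))\<^sup>2"]\<close>)
  then have sw: "((\<lambda>(d,e). (S e \<bullet> d)\<^sup>2) has_sum (\<Sum>\<^sub>\<infinity>e\<in>B. (norm (S e))\<^sup>2)) (D \<times> B)"
    by (subst (asm) has_sum_swap) (simp add: case_prod_unfold)
  have "((\<lambda>e. (S e \<bullet> d)\<^sup>2) has_sum (norm (blinfun_inner_right d o\<^sub>L S))\<^sup>2) B" for d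
    using functional_has_sum[OF B, of "blinfun_inner_right d o\<^sub>L S"] by (simp add: inner_commute)
  then show ?thesis using has_sum_SigmaD[OF sw] by auto
qed

lemma hs_basis_independent:
  fixes S :: "'u::real_inner \<Rightarrow>\<^sub>L 'h::{real_inner, second_countable_topology}"
  assumes B: "orthonormal_basis B" and C: "orthonormal_basis C"
    and summ: "((\<lambda>e. (norm (S e))\<^sup>2) has_sum s) B"
  shows "((\<lambda>e. (norm (S e))\<^sup>2) has_sum s) C"
proof -
  obtain D :: "'h set" where D: "orthonormal_basis D" using orthonormal_basis_exists by blast
  have s: "(\<Sum>\<^sub>\<infinity>e\<in>B. (norm (S e))\<^sup>2) = s" and sB: "(\<lambda>e. (norm (S e))\<^sup>2) summable_on B"
    using summ by (auto simp: infsumI summable_on_def)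
  have 1: "((\<lambda>d. (norm (blinfun_inner_right d o\<^sub>L S))\<^sup>2) has_sum s) D"
    using hs_sum_dual[OF B D sB] s by simp
  let ?f = "\<lambda>(d,e). (S e \<bullet> d)\<^sup>2"
  have C': "((\<lambda>e. (S e \<bullet> d)\<^sup>2) has_sum (norm (blinfun_inner_right d o\<^sub>L S))\<^sup>2) C" for d
    using functional_has_sum[OF C, of "blinfun_inner_right d o\<^sub>L S"] by (simp add: inner_commute)
  have "(?f has_sum s) (D \<times> C)"
    by (rule has_sum_SigmaI[where g = "\<lambda>d. (norm (blinfun_inner_right d o\<^sub>L S))\<^sup>2"])
       (use C' 1 in \<open>auto simp: summable_on_def intro!: summable_on_SigmaI[where g = "\<lambda>d. (norm (blinfun_inner_right d o\<^sub>L S))\<^sup>2", unfolded summable_on_def]\<close>)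
  then have "((\<lambda>(e,d). (S e \<bullet> d)\<^sup>2) has_sum s) (C \<times> D)"
    by (subst (asm) has_sum_swap) (simp add: case_prod_unfold)
  from has_sum_SigmaD[OF this] show ?thesis using parseval_has_sum[OF D] by auto
qed

lemma orthonormal_basis_some:
  "orthonormal_basis (SOME B::'a::{real_inner, second_countable_topology} set. orthonormal_basis B)"
  using orthonormal_basis_exists by (rule someI_ex)

lemma hs_norm_has_sum:
  fixes S :: "'u::{real_inner, second_countable_topology} \<Rightarrow>\<^sub>L 'h::{real_inner, second_countable_topology}"
  assumes "hilbert_schmidt S" "orthonormal_basis B"
  shows "((\<lambda>e. (norm (S e))\<^sup>2) has_sum (hs_norm S)\<^sup>2) B"
proof -
  obtain C where C: "orthonormal_basis C" "(\<lambda>e. (norm (S e))\<^sup>2) summable_on C"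
    using assms(1) unfolding hilbert_schmidt_def by blast
  then obtain s where s: "((\<lambda>e. (norm (S e))\<^sup>2) has_sum s) C" unfolding summable_on_def by blast
  have "((\<lambda>e. (norm (S e))\<^sup>2) has_sum s) (SOME B. orthonormal_basis B)"
    using hs_basis_independent[OF C(1) orthonormal_basis_some s] .
  then have "hs_norm S = sqrt s" by (simp add: hs_norm_def infsumI)
  moreover have "s \<ge> 0" using s by (rule has_sum_nonneg) simp
  ultimately show ?thesis using hs_basis_independent[OF C(1) assms(2) s] by simp
qed

lemma hs_minkowski:
  fixes S S' :: "'u::{real_inner, second_countable_topology} \<Rightarrow>\<^sub>L 'h::{real_inner, second_countable_topology}"
  assumes "hilbert_schmidt S" "hilbert_schmidt S'"
  shows "hilbert_schmidt (S + S')" "hs_norm (S + S') \<le> hs_norm S + hs_norm S'"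
proof -
  obtain B :: "'u set" where B: "orthonormal_basis B" using orthonormal_basis_exists by blast
  note h = hs_norm_has_sum[OF assms(1) B] hs_norm_has_sum[OF assms(2) B]
  have n: "hs_norm T \<ge> 0" for T :: "'u \<Rightarrow>\<^sub>L 'h" by (simp add: hs_norm_def infsum_nonneg)
  have fin: "(\<Sum>e\<in>F. (norm ((S + S') e))\<^sup>2) \<le> (hs_norm S + hs_norm S')\<^sup>2"
    if F: "finite F" "F \<subseteq> B" for F
  proof -
    have b: "L2_set (\<lambda>e. norm (T e)) F \<le> hs_norm T" if "((\<lambda>e. (norm (T e))\<^sup>2) has_sum (hs_norm T)\<^sup>2) B" for T :: "'u \<Rightarrow>\<^sub>L 'h"
    proof -
      have "(\<Sum>e\<in>F. (norm (T e))\<^sup>2) \<le> (hs_norm T)\<^sup>2"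
        using finite_sum_le_has_sum[OF that] F by auto
      then show ?thesis unfolding L2_set_def using n by (simp add: real_le_lsqrt sum_nonneg)
    qed
    have "L2_set (\<lambda>e. norm ((S + S') e)) F \<le> L2_set (\<lambda>e. norm (S e) + norm (S' e)) F"
      by (rule L2_set_mono) (auto simp: plus_blinfun.rep_eq norm_triangle_ineq)
    also have "\<dots> \<le> L2_set (\<lambda>e. norm (S e)) F + L2_set (\<lambda>e. norm (S' e)) F"
      by (rule L2_set_triangle_ineq)
    also have "\<dots> \<le> hs_norm S + hs_norm S'" using b[OF h(1)] b[OF h(2)] by simp
    finally show ?thesis unfolding L2_set_def
      by (meson real_sqrt_le_iff sqrt_le_D)
  qed
  have "bdd_above (sum (\<lambda>e. (norm ((S + S') e))\<^sup>2) ` {F. F \<subseteq> B \<and> finite F})"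
    using fin by (auto intro!: bdd_aboveI[of _ "(hs_norm S + hs_norm S')\<^sup>2"])
  then have summ: "(\<lambda>e. (norm ((S + S') e))\<^sup>2) summable_on B"
    by (intro nonneg_bdd_above_summable_on) auto
  then show hs: "hilbert_schmidt (S + S')" using B unfolding hilbert_schmidt_def by blast
  have "(hs_norm (S + S'))\<^sup>2 \<le> (hs_norm S + hs_norm S')\<^sup>2"
    using has_sum_le_finite_sums[OF hs_norm_has_sum[OF hs B]] fin by blast
  then show "hs_norm (S + S') \<le> hs_norm S + hs_norm S'"
    using n by (meson add_nonneg_nonneg power2_le_imp_le)
qed

lemma hs_norm_uminus: "hs_norm (- S) = hs_norm S"
  and hilbert_schmidt_uminus: "hilbert_schmidt (- S) \<longleftrightarrow> hilbert_schmidt S"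
  by (simp_all add: hs_norm_def hilbert_schmidt_def uminus_blinfun.rep_eq)

lemma hs_norm_eq_0:
  fixes S :: "'u::{real_inner, second_countable_topology} \<Rightarrow>\<^sub>L 'h::{real_inner, second_countable_topology}"
  assumes "hilbert_schmidt S"
  shows "hs_norm S = 0 \<longleftrightarrow> S = 0"
proof
  assume 0: "hs_norm S = 0"
  obtain B :: "'u set" where B: "orthonormal_basis B" using orthonormal_basis_exists by blast
  have z: "S e = 0" if "e \<in> B" for e
    using finite_sum_le_has_sum[OF hs_norm_has_sum[OF assms B], of "{e}"] that 0 by auto
  have "S x = 0" for x
  proof -
    have "span B \<subseteq> {x. S x = 0}"
      by (rule span_minimal) (auto simp: z subspace_def blinfun.add_right blinfun.scaleR_right blinfun.zero_right)
    moreover have "closed {x. S x = 0}" by (intro closed_Collect_eq continuous_intros)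
    moreover have "closure (span B) = UNIV" using B by (simp add: orthonormal_basis_def)
    ultimately show ?thesis using closure_minimal by blast
  qed
  then show "S = 0" by (intro blinfun_eqI) simp
qed (simp add: hs_norm_def)

lemma Metric_space_hs:
  "Metric_space (hs_ops :: ('u::{real_inner, second_countable_topology} \<Rightarrow>\<^sub>L
      'h::{real_inner, second_countable_topology}) set) hs_dist"
proof -
  have d: "hilbert_schmidt (S - S')" if "hilbert_schmidt S" "hilbert_schmidt S'" for S S' :: "'u \<Rightarrow>\<^sub>L 'h"
    using hs_minkowski(1)[of S "- S'"] that by (simp add: hilbert_schmidt_uminus)
  show ?thesis
  proof
    fix S S' S'' :: "'u \<Rightarrow>\<^sub>L 'h"
    show "0 \<le> hs_dist S S'" by (simp add: hs_dist_def hs_norm_def infsum_nonneg)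
    show "hs_dist S S' = hs_dist S' S" using hs_norm_uminus[of "S - S'"] by (simp add: hs_dist_def)
    show "hs_dist S S' = 0 \<longleftrightarrow> S = S'" if "S \<in> hs_ops" "S' \<in> hs_ops"
      using hs_norm_eq_0[of "S - S'"] d that by (simp add: hs_dist_def hs_ops_def)
    show "hs_dist S S'' \<le> hs_dist S S' + hs_dist S' S''"
      if "S \<in> hs_ops" "S' \<in> hs_ops" "S'' \<in> hs_ops"
      using hs_minkowski(2)[of "S - S'" "S' - S''"] d that by (simp add: hs_dist_def hs_ops_def)
  qed
qed

text \<open>The Borel \<open>\<sigma>\<close>-algebra of the Hilbert-Schmidt norm topology, not the trace of the one of the
  operator norm. Its space is \<open>hs_ops\<close>, so measurability into it includes having Hilbert-Schmidt
  values.\<close>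

definition hs_borel :: "('u::real_inner \<Rightarrow>\<^sub>L 'h::real_inner) measure" where
  "hs_borel = sigma hs_ops {V. openin (Metric_space.mtopology hs_ops hs_dist) V}"

section \<open>Complete filtered probability spaces and predictability\<close>

text \<open>Completeness of the filtration means that \<open>F 0\<close> contains all null sets; right-continuity is
  not required. Only the values \<open>F t\<close> with \<open>t \<in> {0..T}\<close> matter.\<close>

locale complete_filtered_prob_space = prob_space M + complete_measure M
  for M :: "'w measure" +
  fixes F :: "real \<Rightarrow> 'w measure" and T :: real
  assumes subalgebra_F: "\<And>t. t \<in> {0..T} \<Longrightarrow> subalgebra M (F t)"
    and mono_F: "\<And>s t. 0 \<le> s \<Longrightarrow> s \<le> t \<Longrightarrow> t \<le> T \<Longrightarrow> sets (F s) \<subseteq> sets (F t)"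
    and null_sets_F: "null_sets M \<subseteq> sets (F 0)"

definition predictable :: "'w measure \<Rightarrow> (real \<Rightarrow> 'w measure) \<Rightarrow> real \<Rightarrow> ('w \<times> real) measure" where
  "predictable M F T = sigma (space M \<times> {0..T})
     ({A \<times> {s<..t} | A s t. 0 \<le> s \<and> s < t \<and> t \<le> T \<and> A \<in> sets (F s)} \<union>
      {A \<times> {0} | A. A \<in> sets (F 0)})"

definition strongly_measurable ::
  "'w measure \<Rightarrow> (real \<Rightarrow> 'w measure) \<Rightarrow> real \<Rightarrow>
   ('w \<times> real \<Rightarrow> 'u::real_normed_vector \<Rightarrow>\<^sub>L 'h::real_normed_vector) \<Rightarrow> bool" where
  "strongly_measurable M F T \<Phi> \<longleftrightarrow>
     (\<forall>u. (\<lambda>p. blinfun_apply (\<Phi> p) u) \<in> borel_measurable (predictable M F T))"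

definition strongly_continuous :: "real \<Rightarrow> (real \<Rightarrow> 'h::real_normed_vector \<Rightarrow>\<^sub>L 'h) \<Rightarrow> bool" where
  "strongly_continuous T R \<longleftrightarrow> (\<forall>h. continuous_on {0<..T} (\<lambda>t. blinfun_apply (R t) h))"

text \<open>The case distinction discards the value of \<open>R\<close> outside \<open>(0, T]\<close>.\<close>

definition conv_map ::
  "(real \<Rightarrow> 'h::real_normed_vector \<Rightarrow>\<^sub>L 'h) \<Rightarrow> ('w \<times> real \<Rightarrow> 'u::real_normed_vector \<Rightarrow>\<^sub>L 'h) \<Rightarrow>
   ('w \<times> real) \<times> real \<Rightarrow> 'u \<Rightarrow>\<^sub>L 'h" where
  "conv_map R \<Phi> = (\<lambda>((\<omega>, s), t). if s \<in> {0..<t} then R (t - s) o\<^sub>L \<Phi> (\<omega>, s) else 0)"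

end

(*
  Both directions test measurability on closed balls, which generate the Borel sets because the
  space of Hilbert-Schmidt operators is separable: membership in a Hilbert-Schmidt ball is a
  countable conjunction of conditions on the operator applied to basis vectors. This gives (i), as
  R(t - s) applied to a predictable H-valued map is jointly measurable by strong continuity.

  For (ii), t = s + t_n makes R(t_n) Phi_s(omega) u measurable on s <= T - t_n. The image R(t_n) C of
  a closed ball C is closed, by weak compactness, so the hypothesis on R describes
  Phi_s(omega) u : C by countably many measurable conditions whenever s < T. No t > s is available at
  s = T, and the exceptional null set is therefore Omega x {T}.
*)

theory Submission
  imports Defs
begin

section \<open>Open sets as countable unions of closed balls\<close>

text \<open>Countability comes from admitting only dense centres and rational radii. The abstract
  carrier lets this serve both the Hilbert space and the Hilbert-Schmidt operators; nonnegative
  radii are recorded for the norm criterion used with the latter.\<close>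

lemma (in Metric_space) openin_countable_union_mcball:
  assumes D: "countable D" "D \<subseteq> M" "\<And>x \<epsilon>. x \<in> M \<Longrightarrow> \<epsilon> > 0 \<Longrightarrow> \<exists>c\<in>D. d c x < \<epsilon>"
    and V: "openin mtopology V"
  obtains I where "countable I" "I \<subseteq> D \<times> {0..}" "V = (\<Union>(c, r)\<in>I. mcball c r)"
proof
  define I where "I = {(c, r). c \<in> D \<and> r \<in> \<rat> \<inter> {0..} \<and> mcball c r \<subseteq> V}"
  have "countable (D \<times> (\<rat> \<inter> {0::real..}))"
    using D(1) countable_rat by (intro countable_SIGMA) auto
  then show "countable I" by (rule countable_subset[rotated]) (auto simp: I_def)
  show "I \<subseteq> D \<times> {0..}" by (auto simp: I_def)
  show "V = (\<Union>(c, r)\<in>I. mcball c r)"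
  proof (intro equalityI subsetI)
    fix x assume "x \<in> V"
    then obtain \<epsilon> where \<epsilon>: "\<epsilon> > 0" "mball x \<epsilon> \<subseteq> V" and x: "x \<in> M"
      using V unfolding openin_mtopology by blast
    \<comment> \<open>A radius above \<open>\<epsilon> / 4\<close> makes the ball about a centre
      that close contain \<open>x\<close>, and
      \<open>\<epsilon> / 4 + \<epsilon> / 2 < \<epsilon>\<close> keeps the ball inside
      \<open>mball x \<epsilon>\<close>.\<close>
    obtain r where r: "r \<in> \<rat>" "\<epsilon> / 4 < r" "r < \<epsilon> / 2"
      using Rats_dense_in_real[of "\<epsilon> / 4" "\<epsilon> / 2"] \<epsilon> by auto
    obtain c where c: "c \<in> D" "d c x < \<epsilon> / 4"
      using D(3)[OF x, of "\<epsilon> / 4"] \<epsilon> by auto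
    have cM: "c \<in> M" using c D(2) by auto
    have "mcball c r \<subseteq> mball x \<epsilon>"
    proof
      fix y assume "y \<in> mcball c r"
      then have y: "y \<in> M" "d c y \<le> r" by auto
      have "d x y \<le> d c x + d c y" using triangle[OF x cM y(1)] commute[of x c] by simp
      then show "y \<in> mball x \<epsilon>" using x y c r \<epsilon> by auto
    qed
    then have "(c, r) \<in> I" using c r \<epsilon> by (auto simp: I_def)
    moreover have "x \<in> mcball c r" using x cM c r by auto
    ultimately show "x \<in> (\<Union>(c, r)\<in>I. mcball c r)"
      by (intro UN_I[of "(c, r)"]) auto
  qed (auto simp: I_def)
qed

text \<open>By separability the preimage of an open set is a countable union of preimages of closed
  balls. Closed balls are convex and bounded, so the hypothesis on \<open>R\<close> applies to
  them.\<close>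

lemma borel_measurable_cballI:
  fixes f :: "'a \<Rightarrow> 'b::{metric_space, second_countable_topology}"
  assumes "\<And>c r. {x \<in> space N. f x \<in> cball c r} \<in> sets N"
  shows "f \<in> borel_measurable N"
proof (rule borel_measurableI)
  fix S :: "'b set" assume "open S"
  obtain D :: "'b set" where D: "countable D" "\<And>X. open X \<Longrightarrow> X \<noteq> {} \<Longrightarrow> \<exists>d\<in>D. d \<in> X"
    using countable_dense_setE by blast
  have "\<exists>c\<in>D. dist c x < \<epsilon>" if "\<epsilon> > 0" for x \<epsilon>
    using D(2)[of "ball x \<epsilon>"] that by (auto simp: dist_commute)
  then obtain I where I: "countable I" "S = (\<Union>(c, r)\<in>I. cball c r)"
    using Met_TC.openin_countable_union_mcball[of D S] D(1) \<open>open S\<close>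
    unfolding mtopology_is_euclidean open_openin[symmetric] mcball_eq_cball by (metis UNIV_I subset_UNIV)
  have "f -` S \<inter> space N = (\<Union>(c, r)\<in>I. {x \<in> space N. f x \<in> cball c r})"
    unfolding I(2) case_prod_unfold by blast
  also have "\<dots> \<in> sets N" using I(1) assms by (intro sets.countable_UN'') auto
  finally show "f -` S \<inter> space N \<in> sets N" .
qed

section \<open>The space of Hilbert-Schmidt operators\<close>

text \<open>A dense point close to a basis vector is not orthogonal to it, whereas by Parseval each
  point has nonzero coefficients at only countably many basis vectors.\<close>

lemma countable_orthonormal_basis:
  fixes B :: "'a::{real_inner, second_countable_topology} set"
  assumes B: "orthonormal_basis B"
  shows "countable B"
proof -
  obtain D :: "'a set" where D: "countable D" "\<And>X. open X \<Longrightarrow> X \<noteq> {} \<Longrightarrow> \<exists>d\<in>D. d \<in> X"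
    using countable_dense_setE by blast
  have "B \<subseteq> (\<Union>d\<in>D. {b \<in> B. (d \<bullet> b)\<^sup>2 \<noteq> 0})"
  proof
    fix b assume b: "b \<in> B"
    then have nb: "norm b = 1" using B by (auto simp: orthonormal_basis_def orthonormal_def)
    obtain d where d: "d \<in> D" "norm (b - d) < 1"
      using D(2)[of "ball b 1"] by (auto simp: dist_norm)
    have "d \<bullet> b \<noteq> 0"
    proof
      assume "d \<bullet> b = 0"
      then have "1 = (b - d) \<bullet> b" using nb by (simp add: inner_diff_left norm_eq_1)
      also have "\<dots> \<le> norm (b - d) * norm b" by (rule norm_cauchy_schwarz)
      finally show False using nb d by simp
    qed
    then show "b \<in> (\<Union>d\<in>D. {b \<in> B. (d \<bullet> b)\<^sup>2 \<noteq> 0})" using b d by auto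
  qed
  moreover have "countable {b \<in> B. (d \<bullet> b)\<^sup>2 \<noteq> 0}" for d
    using parseval_has_sum[OF B, of d] by (intro summable_countable_real) (auto simp: summable_on_def)
  ultimately show ?thesis using D(1) by (meson countable_UN countable_subset)
qed

lemma hs_norm_nonneg: "hs_norm S \<ge> 0"
  by (simp add: hs_norm_def infsum_nonneg)

lemma hilbert_schmidt_diff:
  fixes S S' :: "'u::{real_inner, second_countable_topology} \<Rightarrow>\<^sub>L 'h::{real_inner, second_countable_topology}"
  assumes "hilbert_schmidt S" "hilbert_schmidt S'"
  shows "hilbert_schmidt (S - S')"
  using hs_minkowski(1)[of S "- S'"] assms by (simp add: hilbert_schmidt_uminus)

text \<open>Reduces a norm bound to finite conditions, countably many because orthonormal bases are
  countable. The hypothesis on \<open>S\<close> matters: a non-summable \<open>infsum\<close> is 0,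
  so \<open>hs_norm\<close> vanishes on operators that are not Hilbert-Schmidt.\<close>

lemma hs_norm_le_iff:
  fixes S :: "'u::{real_inner, second_countable_topology} \<Rightarrow>\<^sub>L 'h::{real_inner, second_countable_topology}"
  assumes S: "hilbert_schmidt S" and B: "orthonormal_basis B" and r: "r \<ge> 0"
  shows "hs_norm S \<le> r \<longleftrightarrow> (\<forall>F. finite F \<and> F \<subseteq> B \<longrightarrow> (\<Sum>e\<in>F. (norm (S e))\<^sup>2) \<le> r\<^sup>2)"
proof
  assume "hs_norm S \<le> r"
  then have "(hs_norm S)\<^sup>2 \<le> r\<^sup>2" by (intro power_mono hs_norm_nonneg)
  then show "\<forall>F. finite F \<and> F \<subseteq> B \<longrightarrow> (\<Sum>e\<in>F. (norm (S e))\<^sup>2) \<le> r\<^sup>2"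
    using finite_sum_le_has_sum[OF hs_norm_has_sum[OF S B]] by fastforce
next
  assume "\<forall>F. finite F \<and> F \<subseteq> B \<longrightarrow> (\<Sum>e\<in>F. (norm (S e))\<^sup>2) \<le> r\<^sup>2"
  then have "(hs_norm S)\<^sup>2 \<le> r\<^sup>2"
    using has_sum_le_finite_sums[OF hs_norm_has_sum[OF S B]] by blast
  then show "hs_norm S \<le> r" using r by (rule power2_le_imp_le)
qed

text \<open>Makes evaluation at a vector Lipschitz for \<open>hs_dist\<close>.\<close>

lemma norm_apply_le_hs_norm:
  fixes S :: "'u::{real_inner, second_countable_topology} \<Rightarrow>\<^sub>L 'h::{real_inner, second_countable_topology}"
  assumes S: "hilbert_schmidt S"
  shows "norm (S u) \<le> hs_norm S * norm u"
proof -
  obtain B :: "'u set" where B: "orthonormal_basis B" using orthonormal_basis_exists by blast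
  \<comment> \<open>At \<open>u\<close> this functional takes the square of
    \<open>norm (S u)\<close> as its value. Its norm is computed from its values on the basis, so
    \<open>u\<close> need not be expanded.\<close>
  define \<phi> where "\<phi> = blinfun_inner_right (S u) o\<^sub>L S"
  have "(norm \<phi>)\<^sup>2 \<le> (norm (S u))\<^sup>2 * (hs_norm S)\<^sup>2"
  proof (rule has_sum_mono[OF functional_has_sum[OF B] has_sum_cmult_right[OF hs_norm_has_sum[OF S B]]])
    fix e
    have "\<bar>\<phi> e\<bar> \<le> norm (S u) * norm (S e)" by (simp add: \<phi>_def Cauchy_Schwarz_ineq2)
    then show "(\<phi> e)\<^sup>2 \<le> (norm (S u))\<^sup>2 * (norm (S e))\<^sup>2"
      by (metis abs_ge_zero power2_abs power_mono power_mult_distrib)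
  qed
  then have le: "norm \<phi> \<le> norm (S u) * hs_norm S"
    by (intro power2_le_imp_le[of "norm \<phi>"]) (auto simp: power_mult_distrib hs_norm_nonneg)
  have "norm (S u) * norm (S u) = \<phi> u" by (simp add: \<phi>_def dot_square_norm power2_eq_square)
  also have "\<dots> \<le> norm \<phi> * norm u" using norm_blinfun[of \<phi> u] by simp
  also have "\<dots> \<le> norm (S u) * (hs_norm S * norm u)"
    using le by (metis mult.assoc mult_right_mono norm_ge_zero)
  finally show ?thesis
    by (cases "norm (S u) = 0") (auto simp: hs_norm_nonneg)
qed

text \<open>For finite orthonormal \<open>E\<close> this is the operator that agrees with
  \<open>g\<close> on \<open>E\<close> and vanishes on the orthogonal complement of
  \<open>E\<close>.\<close>

definition finite_rank :: "'u::real_inner set \<Rightarrow> ('u \<Rightarrow> 'h::real_inner) \<Rightarrow> 'u \<Rightarrow>\<^sub>L 'h" where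
  "finite_rank E g = (\<Sum>e\<in>E. blinfun_scaleR_left (g e) o\<^sub>L blinfun_inner_right e)"

lemma finite_rank_basis:
  assumes "orthonormal B" "finite E" "E \<subseteq> B" "b \<in> B"
  shows "finite_rank E g b = (if b \<in> E then g b else 0)"
proof -
  have "finite_rank E g b = (\<Sum>e\<in>E. (e \<bullet> b) *\<^sub>R g e)"
    by (simp add: finite_rank_def blinfun.sum_left)
  also have "\<dots> = (\<Sum>e\<in>E. if e = b then g b else 0)"
  proof (intro sum.cong refl)
    fix e assume "e \<in> E"
    then show "(e \<bullet> b) *\<^sub>R g e = (if e = b then g b else 0)"
      using assms unfolding orthonormal_def pairwise_def orthogonal_def
      by (auto simp: norm_eq_1)
  qed
  finally show ?thesis using assms(2) by simp
qed

lemma hilbert_schmidt_finite_rank: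
  assumes B: "orthonormal_basis B" and E: "finite E" "E \<subseteq> B"
  shows "hilbert_schmidt (finite_rank E g)"
proof -
  have "(\<lambda>e. (norm (finite_rank E g e))\<^sup>2) summable_on E" using E(1) by (rule summable_on_finite)
  then have "(\<lambda>e. (norm (finite_rank E g e))\<^sup>2) summable_on B"
    by (rule summable_on_cong_neutral[THEN iffD1, rotated -1])
       (use B E in \<open>auto simp: finite_rank_basis orthonormal_basis_def\<close>)
  then show ?thesis using B by (auto simp: hilbert_schmidt_def)
qed

text \<open>Finite-rank operators that live on finitely many basis vectors, with values there in a
  countable dense set, are dense because tails of the Hilbert-Schmidt series are small.\<close>

lemma hs_ops_separable:
  obtains D :: "('u::{real_inner, second_countable_topology} \<Rightarrow>\<^sub>L 'h::{real_inner, second_countable_topology}) set"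
  where "countable D" "D \<subseteq> hs_ops"
    "\<And>S \<epsilon>. S \<in> hs_ops \<Longrightarrow> \<epsilon> > 0 \<Longrightarrow> \<exists>S'\<in>D. hs_dist S' S < \<epsilon>"
proof -
  obtain B :: "'u set" where B: "orthonormal_basis B" using orthonormal_basis_exists by blast
  then have on: "orthonormal B" by (simp add: orthonormal_basis_def)
  obtain H :: "'h set" where H: "countable H" "\<And>X. open X \<Longrightarrow> X \<noteq> {} \<Longrightarrow> \<exists>d\<in>H. d \<in> X"
    using countable_dense_setE by blast
  \<comment> \<open>Extensional functions carry no data outside the finite set \<open>E\<close>,
    which makes the set of admissible \<open>g\<close> countable.\<close>
  define D where "D = (\<lambda>(E, g). finite_rank E g) ` (SIGMA E:{E. finite E \<and> E \<subseteq> B}. E \<rightarrow>\<^sub>E H)"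
  show thesis
  proof
    show "countable D"
      unfolding D_def using countable_orthonormal_basis[OF B] H(1)
      by (intro countable_image countable_SIGMA)
         (auto intro: countable_PiE countable_Collect_finite_subset simp: conj_commute)
    show "D \<subseteq> hs_ops"
      using hilbert_schmidt_finite_rank[OF B] by (auto simp: D_def hs_ops_def)
    fix S :: "'u \<Rightarrow>\<^sub>L 'h" and \<epsilon> :: real assume "S \<in> hs_ops" and \<epsilon>: "\<epsilon> > 0"
    then have S: "hilbert_schmidt S" by (simp add: hs_ops_def)
    note sumS = hs_norm_has_sum[OF S B]
    \<comment> \<open>The squared error will be at most \<open>\<delta>\<close> on \<open>E\<close>
      and \<open>\<delta>\<close> off \<open>E\<close>, and \<open>2 * \<delta>\<close> is half the
      square of \<open>\<epsilon>\<close>.\<close>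
    define \<delta> where "\<delta> = \<epsilon>\<^sup>2 / 4"
    have \<delta>: "\<delta> > 0" using \<epsilon> by (simp add: \<delta>_def)
    obtain E where E: "finite E" "E \<subseteq> B" "(hs_norm S)\<^sup>2 - \<delta> < (\<Sum>e\<in>E. (norm (S e))\<^sup>2)"
    proof (rule ccontr)
      assume "\<not> thesis"
      then have "(hs_norm S)\<^sup>2 \<le> (hs_norm S)\<^sup>2 - \<delta>"
        using that by (intro has_sum_le_finite_sums[OF sumS]) force
      then show False using \<delta> by simp
    qed
    \<comment> \<open>The budget \<open>\<delta>\<close> is shared among the elements of
      \<open>E\<close>; adding 1 covers the empty set.\<close>
    define \<eta> where "\<eta> = \<delta> / (card E + 1)"
    have \<eta>: "\<eta> > 0" using \<delta> by (simp add: \<eta>_def)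
    have "\<exists>y\<in>H. (norm (y - S e))\<^sup>2 < \<eta>" for e
    proof -
      obtain y where "y \<in> H" "dist (S e) y < sqrt \<eta>"
        using H(2)[of "ball (S e) (sqrt \<eta>)"] \<eta> by auto
      then show ?thesis using \<eta>
        by (intro bexI[of _ y]) (auto simp: dist_norm norm_minus_commute sqrt_ge_absD real_less_rsqrt
             intro: order.strict_trans2[OF power_strict_mono[of _ "sqrt \<eta>" 2]])
    qed
    then obtain g0 where g0: "\<And>e. g0 e \<in> H" "\<And>e. (norm (g0 e - S e))\<^sup>2 < \<eta>" by metis
    define g where "g = restrict g0 E"
    define S' where "S' = finite_rank E g"
    have hS': "hilbert_schmidt S'" unfolding S'_def by (rule hilbert_schmidt_finite_rank[OF B E(1,2)])
    have "S' \<in> D" using E g0 by (auto simp: D_def S'_def g_def intro!: image_eqI[of _ _ "(E, restrict g0 E)"])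
    have "hs_norm (S' - S) \<le> sqrt (2 * \<delta>)"
      unfolding hs_norm_le_iff[OF hilbert_schmidt_diff[OF hS' S] B real_sqrt_ge_zero[OF less_imp_le[OF mult_pos_pos[OF zero_less_numeral \<delta>]]]]
    proof (intro allI impI)
      fix G assume G: "finite G \<and> G \<subseteq> B"
      \<comment> \<open>Enlarging \<open>G\<close> by \<open>E\<close> splits the error into the
        approximation on \<open>E\<close> and a tail, on which \<open>S'\<close> vanishes.\<close>
      have "(\<Sum>e\<in>G. (norm ((S' - S) e))\<^sup>2) \<le> (\<Sum>e\<in>E \<union> (G - E). (norm ((S' - S) e))\<^sup>2)"
        using E G by (intro sum_mono2) auto
      also have "\<dots> = (\<Sum>e\<in>E. (norm ((S' - S) e))\<^sup>2) + (\<Sum>e\<in>G - E. (norm ((S' - S) e))\<^sup>2)"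
        using E G by (intro sum.union_disjoint) auto
      also have "(\<Sum>e\<in>E. (norm ((S' - S) e))\<^sup>2) \<le> (\<Sum>e\<in>E. \<eta>)"
        using E g0(2) by (intro sum_mono)
          (auto simp: minus_blinfun.rep_eq S'_def g_def finite_rank_basis[OF on E(1,2)] subset_iff less_imp_le)
      also have "(\<Sum>e\<in>E. \<eta>) \<le> \<delta>" using \<delta> by (simp add: \<eta>_def field_simps)
      also have "(\<Sum>e\<in>G - E. (norm ((S' - S) e))\<^sup>2) = (\<Sum>e\<in>G - E. (norm (S e))\<^sup>2)"
        using G by (intro sum.cong refl)
          (auto simp: minus_blinfun.rep_eq S'_def finite_rank_basis[OF on E(1,2)] subset_iff)
      also have "(\<Sum>e\<in>G - E. (norm (S e))\<^sup>2) \<le> \<delta>"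
      proof -
        have "(\<Sum>e\<in>E. (norm (S e))\<^sup>2) + (\<Sum>e\<in>G - E. (norm (S e))\<^sup>2) = (\<Sum>e\<in>E \<union> (G - E). (norm (S e))\<^sup>2)"
          using E G by (intro sum.union_disjoint[symmetric]) auto
        also have "\<dots> \<le> (hs_norm S)\<^sup>2"
          using E G by (intro finite_sum_le_has_sum[OF sumS]) auto
        finally show ?thesis using E(3) by simp
      qed
      finally show "(\<Sum>e\<in>G. (norm ((S' - S) e))\<^sup>2) \<le> (sqrt (2 * \<delta>))\<^sup>2" using \<delta> by simp
    qed
    also have "sqrt (2 * \<delta>) < \<epsilon>"
      using \<epsilon> by (intro real_less_lsqrt) (auto simp: \<delta>_def)
    finally show "\<exists>S'\<in>D. hs_dist S' S < \<epsilon>" using \<open>S' \<in> D\<close> by (auto simp: hs_dist_def)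
  qed
qed

section \<open>Measurability for the Hilbert-Schmidt Borel sets\<close>

lemma space_hs_borel: "space (hs_borel :: ('u::{real_inner, second_countable_topology} \<Rightarrow>\<^sub>L
      'h::{real_inner, second_countable_topology}) measure) = hs_ops"
  and sets_hs_borel: "sets (hs_borel :: ('u \<Rightarrow>\<^sub>L 'h) measure) =
      sigma_sets hs_ops {V. openin (Metric_space.mtopology hs_ops hs_dist) V}"
proof -
  interpret Metric_space "hs_ops :: ('u \<Rightarrow>\<^sub>L 'h) set" hs_dist by (rule Metric_space_hs)
  have "{V. openin mtopology V} \<subseteq> Pow (hs_ops :: ('u \<Rightarrow>\<^sub>L 'h) set)"
    by (auto simp: openin_mtopology)
  then show "space (hs_borel :: ('u \<Rightarrow>\<^sub>L 'h) measure) = hs_ops"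
    "sets (hs_borel :: ('u \<Rightarrow>\<^sub>L 'h) measure) =
      sigma_sets hs_ops {V. openin (Metric_space.mtopology hs_ops hs_dist) V}"
    by (simp_all add: hs_borel_def)
qed

text \<open>By separability it suffices to test closed Hilbert-Schmidt balls, and membership in such
  a ball is a countable conjunction of inequalities between finite sums of measurable
  functions.\<close>

lemma measurable_hs_borelI:
  fixes X :: "'a \<Rightarrow> 'u::{real_inner, second_countable_topology} \<Rightarrow>\<^sub>L 'h::{real_inner, second_countable_topology}"
  assumes hs: "\<And>x. x \<in> space N \<Longrightarrow> hilbert_schmidt (X x)"
    and meas: "\<And>u. (\<lambda>x. X x u) \<in> borel_measurable N"
  shows "X \<in> measurable N hs_borel"
proof -
  interpret Metric_space "hs_ops :: ('u \<Rightarrow>\<^sub>L 'h) set" hs_dist by (rule Metric_space_hs)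
  obtain B :: "'u set" where B: "orthonormal_basis B" using orthonormal_basis_exists by blast
  have fin: "countable {E. finite E \<and> E \<subseteq> B}"
    using countable_Collect_finite_subset[OF countable_orthonormal_basis[OF B]] .
  obtain D :: "('u \<Rightarrow>\<^sub>L 'h) set" where D: "countable D" "D \<subseteq> hs_ops"
    "\<And>S \<epsilon>. S \<in> hs_ops \<Longrightarrow> \<epsilon> > 0 \<Longrightarrow> \<exists>S'\<in>D. hs_dist S' S < \<epsilon>"
    using hs_ops_separable by blast
  have ball: "{x \<in> space N. X x \<in> mcball S r} \<in> sets N" if S: "S \<in> D" and r: "r \<ge> 0" for S r
  proof -
    have hS: "hilbert_schmidt S" using S D(2) by (auto simp: hs_ops_def)
    have "X x \<in> hs_ops" if "x \<in> space N" for x using hs[OF that] by (simp add: hs_ops_def)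
    then have "{x \<in> space N. X x \<in> mcball S r} = {x \<in> space N. hs_norm (S - X x) \<le> r}"
      using S D(2) by (auto simp: hs_dist_def)
    also have "\<dots> = {x \<in> space N. \<forall>E\<in>{E. finite E \<and> E \<subseteq> B}. (\<Sum>e\<in>E. (norm (S e - X x e))\<^sup>2) \<le> r\<^sup>2}"
      using hs_norm_le_iff[OF hilbert_schmidt_diff[OF hS hs] B r]
      by (auto simp: minus_blinfun.rep_eq)
    also have "\<dots> \<in> sets N"
      using meas by (intro sets.sets_Collect_countable_All' fin) measurable
    finally show ?thesis .
  qed
  show ?thesis
    unfolding hs_borel_def
  proof (rule measurable_measure_of)
    show "{V. openin mtopology V} \<subseteq> Pow (hs_ops :: ('u \<Rightarrow>\<^sub>L 'h) set)"
      by (auto simp: openin_mtopology)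
    show "X \<in> space N \<rightarrow> hs_ops" using hs by (auto simp: hs_ops_def)
    fix V :: "('u \<Rightarrow>\<^sub>L 'h) set" assume "V \<in> {V. openin mtopology V}"
    then obtain I where I: "countable I" "I \<subseteq> D \<times> {0..}" "V = (\<Union>(S, r)\<in>I. mcball S r)"
      using openin_countable_union_mcball[OF D] by blast
    have "X -` V \<inter> space N = (\<Union>(S, r)\<in>I. {x \<in> space N. X x \<in> mcball S r})"
      unfolding I(3) case_prod_unfold by blast
    also have "\<dots> \<in> sets N"
      using I(1,2) ball by (intro sets.countable_UN'') auto
    finally show "X -` V \<inter> space N \<in> sets N" .
  qed
qed

text \<open>Evaluation is continuous for the Hilbert-Schmidt metric. Composition with it turns
  measurability into \<open>hs_borel\<close> back into pointwise measurability.\<close>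

lemma measurable_hs_borel_apply:
  fixes u :: "'u::{real_inner, second_countable_topology}"
  shows "(\<lambda>S. blinfun_apply S u :: 'h::{real_inner, second_countable_topology}) \<in> borel_measurable hs_borel"
proof (rule borel_measurableI)
  interpret Metric_space "hs_ops :: ('u \<Rightarrow>\<^sub>L 'h) set" hs_dist by (rule Metric_space_hs)
  fix V :: "'h set" assume V: "open V"
  have "openin mtopology ((\<lambda>S. blinfun_apply S u) -` V \<inter> hs_ops)"
    unfolding openin_mtopology
  proof (intro conjI allI impI)
    fix S assume S: "S \<in> (\<lambda>S. blinfun_apply S u) -` V \<inter> hs_ops"
    then obtain \<epsilon> where \<epsilon>: "\<epsilon> > 0" "ball (S u) \<epsilon> \<subseteq> V"
      using V open_contains_ball by blast
    \<comment> \<open>Dividing by \<open>norm u + 1\<close> covers the case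
      \<open>u = 0\<close>.\<close>
    have "mball S (\<epsilon> / (norm u + 1)) \<subseteq> (\<lambda>S. blinfun_apply S u) -` V \<inter> hs_ops"
    proof
      fix S' assume "S' \<in> mball S (\<epsilon> / (norm u + 1))"
      then have S': "S' \<in> hs_ops" "hs_norm (S - S') < \<epsilon> / (norm u + 1)" by (auto simp: hs_dist_def)
      have "hilbert_schmidt (S - S')"
        using S S' by (intro hilbert_schmidt_diff) (auto simp: hs_ops_def)
      from norm_apply_le_hs_norm[OF this, of u]
      have "norm (S u - S' u) \<le> hs_norm (S - S') * (norm u + 1)"
        using hs_norm_nonneg[of "S - S'"] by (simp add: minus_blinfun.rep_eq algebra_simps)
      also have "\<dots> < \<epsilon>" using S'(2) by (simp add: pos_less_divide_eq add_nonneg_pos)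
      finally have "S' u \<in> ball (S u) \<epsilon>" by (simp add: dist_norm)
      then show "S' \<in> (\<lambda>S. blinfun_apply S u) -` V \<inter> hs_ops" using \<epsilon> S' by auto
    qed
    then show "\<exists>r>0. mball S r \<subseteq> (\<lambda>S. blinfun_apply S u) -` V \<inter> hs_ops"
      using \<epsilon>(1) by (intro exI[of _ "\<epsilon> / (norm u + 1)"]) (auto simp: add_nonneg_pos)
  qed auto
  then show "(\<lambda>S. blinfun_apply S u) -` V \<inter> space hs_borel \<in> sets hs_borel"
    by (auto simp: space_hs_borel sets_hs_borel)
qed

section \<open>Images of closed bounded convex sets\<close>

text \<open>Substitute for weak compactness: almost minimal-norm elements of the sets form a Cauchy
  sequence by the parallelogram law.\<close>

lemma decseq_closed_convex_Inter_nonempty: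
  fixes K :: "nat \<Rightarrow> 'a::{real_inner, complete_space} set"
  assumes K: "\<And>n. closed (K n)" "\<And>n. convex (K n)" "\<And>n. K n \<noteq> {}" "decseq K" and bd: "bounded (K 0)"
  shows "(\<Inter>n. K n) \<noteq> {}"
proof -
  define d where "d n = Inf (norm ` K n)" for n
  have bb: "bdd_below (norm ` K n)" for n by (auto intro: bdd_belowI[of _ 0])
  have sub: "K n \<subseteq> K m" if "m \<le> n" for m n using K(4) that by (auto simp: decseq_def)
  have d_le: "d n \<le> norm x" if "x \<in> K n" for n x
    unfolding d_def using that bb by (intro cInf_lower) auto
  have d_nonneg: "d n \<ge> 0" for n unfolding d_def using K(3) by (intro cInf_greatest) auto
  have d_mono: "incseq d"
    unfolding incseq_def d_def using sub K(3) bb by (auto intro!: cInf_superset_mono)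
  \<comment> \<open>The slack tends to 0, so the norms of the chosen points have the same limit as
    \<open>d\<close>.\<close>
  have ex: "\<exists>x\<in>K n. norm x < d n + 1 / real (Suc n)" for n
    using cInf_lessD[of "norm ` K n" "d n + 1 / real (Suc n)"] K(3) by (auto simp: d_def)
  then obtain x where x: "\<And>n. x n \<in> K n" "\<And>n. norm (x n) < d n + 1 / real (Suc n)" by metis
  obtain b where b: "\<And>x. x \<in> K 0 \<Longrightarrow> norm x \<le> b" using bd by (auto simp: bounded_iff)
  have "d n \<le> b" for n using d_le[OF x(1)[of n]] b[of "x n"] sub[of 0 n] x(1)[of n] by force
  then obtain l where l: "d \<longlonglongrightarrow> l" using incseq_convergent[OF d_mono, of b] by metis
  define g where "g n = (d n + 1 / real (Suc n))\<^sup>2" for n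
  have "(\<lambda>n. d n + 1 / real (Suc n)) \<longlonglongrightarrow> l + 0"
    by (intro tendsto_add l lim_1_over_n[THEN LIMSEQ_Suc, simplified] LIMSEQ_inverse_real_of_nat[unfolded inverse_eq_divide])
  then have g: "g \<longlonglongrightarrow> l\<^sup>2" unfolding g_def by (intro tendsto_power) simp
  have d2: "(\<lambda>n. (d n)\<^sup>2) \<longlonglongrightarrow> l\<^sup>2" by (intro tendsto_power l)
  have est: "(dist (x m) (x n))\<^sup>2 \<le> 2 * g m + 2 * g n - 4 * (d m)\<^sup>2" if "m \<le> n" for m n
  proof -
    \<comment> \<open>As the sets decrease, both points lie in \<open>K m\<close>, and convexity
      puts the midpoint there. Its norm is thus at least \<open>d m\<close>, and the parallelogram
      law bounds the distance.\<close>
    have "(1/2) *\<^sub>R x m + (1/2) *\<^sub>R x n \<in> K m"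
      using K(2)[of m] x(1)[of m] x(1)[of n] sub[OF that] by (intro convexD) auto
    then have "d m \<le> norm ((1/2) *\<^sub>R (x m + x n))" using d_le by (simp add: scaleR_add_right)
    then have "(2 * d m)\<^sup>2 \<le> (norm (x m + x n))\<^sup>2" using d_nonneg by (intro power_mono) auto
    moreover have "(norm (x m - x n))\<^sup>2 + (norm (x m + x n))\<^sup>2 = 2 * (norm (x m))\<^sup>2 + 2 * (norm (x n))\<^sup>2"
      unfolding power2_norm_eq_inner by (simp add: algebra_simps inner_commute)
    moreover have "(norm (x i))\<^sup>2 \<le> g i" for i
      unfolding g_def using x(2)[of i] by (intro power_mono) auto
    from this[of m] this[of n]
    have "2 * (norm (x m))\<^sup>2 + 2 * (norm (x n))\<^sup>2 \<le> 2 * g m + 2 * g n" by simp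
    ultimately show ?thesis by (simp add: dist_norm power_mult_distrib)
  qed
  have "Cauchy x"
  proof (rule metric_CauchyI)
    fix e :: real assume e: "e > 0"
    \<comment> \<open>In the estimate the terms in \<open>l\<close> cancel and the errors add up to
      \<open>2/16 + 2/16 + 4/16\<close>, that is, half of the square of \<open>e\<close>.\<close>
    have ev: "eventually (\<lambda>n. \<bar>g n - l\<^sup>2\<bar> < e\<^sup>2 / 16 \<and> \<bar>(d n)\<^sup>2 - l\<^sup>2\<bar> < e\<^sup>2 / 16) sequentially"
      using e tendstoD[OF g, of "e\<^sup>2 / 16"] tendstoD[OF d2, of "e\<^sup>2 / 16"]
      by (auto simp: dist_real_def eventually_conj_iff)
    then obtain N where N: "\<And>n. n \<ge> N \<Longrightarrow> \<bar>g n - l\<^sup>2\<bar> < e\<^sup>2 / 16 \<and> \<bar>(d n)\<^sup>2 - l\<^sup>2\<bar> < e\<^sup>2 / 16"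
      by (auto simp: eventually_sequentially)
    have main: "dist (x m) (x n) < e" if "m \<le> n" "N \<le> m" for m n
    proof -
      have "(dist (x m) (x n))\<^sup>2 < e\<^sup>2"
        using est[OF that(1)] N[OF that(2)] N[of n] that zero_less_power[OF e, of 2] by linarith
      then show ?thesis using e by (intro power2_less_imp_less[of _ e]) auto
    qed
    show "\<exists>M. \<forall>m\<ge>M. \<forall>n\<ge>M. dist (x m) (x n) < e"
      by (intro exI[of _ N]) (metis main dist_commute nat_le_linear)
  qed
  then obtain y where y: "x \<longlonglongrightarrow> y" using Cauchy_convergent convergent_def by blast
  have "y \<in> K n" for n
  proof (rule Lim_in_closed_set[OF K(1) _ _ y])
    show "eventually (\<lambda>m. x m \<in> K n) sequentially"
      unfolding eventually_sequentially using x(1) sub by blast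
  qed auto
  then show ?thesis by auto
qed

text \<open>For a limit \<open>l\<close> of image points, the points of \<open>C\<close> mapped into
  shrinking closed balls about \<open>l\<close> form decreasing, nonempty, closed, convex, bounded
  sets. A common point is mapped to \<open>l\<close>.\<close>

lemma closed_blinfun_image:
  fixes A :: "'a::{real_inner, complete_space} \<Rightarrow>\<^sub>L 'b::real_normed_vector"
  assumes C: "closed C" "convex C" "bounded C"
  shows "closed (A ` C)"
  unfolding closed_sequential_limits
proof (intro allI impI)
  fix y l assume "(\<forall>n. y n \<in> A ` C) \<and> y \<longlonglongrightarrow> l"
  then have yC: "\<And>n. y n \<in> A ` C" and y: "y \<longlonglongrightarrow> l" by auto
  define K where "K n = C \<inter> A -` cball l (1 / real (Suc n))" for n
  have "(\<Inter>n. K n) \<noteq> {}"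
  proof (rule decseq_closed_convex_Inter_nonempty)
    show "closed (K n)" for n
      unfolding K_def by (intro closed_Int C closed_vimage closed_cball continuous_intros)
    show "convex (K n)" for n
      unfolding K_def by (intro convex_Int C convex_linear_vimage convex_cball)
         (auto intro: bounded_linear.linear blinfun.bounded_linear_right)
    show "K n \<noteq> {}" for n
    proof -
      have "eventually (\<lambda>i. dist (y i) l < 1 / real (Suc n)) sequentially" by (rule tendstoD[OF y]) simp
      then obtain i where "dist (y i) l < 1 / real (Suc n)" by (auto simp: eventually_sequentially)
      moreover obtain c where "c \<in> C" "y i = A c" using yC by auto
      ultimately show ?thesis by (auto simp: K_def dist_commute intro!: exI[of _ c])
    qed
    have "1 / real (Suc n) \<le> 1 / real (Suc m)" if "m \<le> n" for m n
      using that by (intro divide_left_mono) auto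
    from subset_cball[OF this] show "decseq K"
      unfolding decseq_def K_def by blast
    show "bounded (K 0)" unfolding K_def using C(3) by (rule bounded_subset) auto
  qed
  then obtain c where c: "\<And>n. c \<in> K n" by auto
  have "dist l (A c) \<le> 0"
  proof (rule LIMSEQ_le_const[OF LIMSEQ_inverse_real_of_nat])
    show "\<exists>N. \<forall>n\<ge>N. dist l (A c) \<le> inverse (real (Suc n))"
      using c by (auto simp: K_def inverse_eq_divide)
  qed
  then show "l \<in> A ` C" using c[of 0] by (auto simp: K_def)
qed

section \<open>Measurability\<close>

context complete_filtered_prob_space
begin

text \<open>Allows the space and the measurable sets of \<open>predictable\<close> to be read off
  from \<open>sigma\<close>.\<close>

lemma generator_predictable_subset:
  "{A \<times> {s<..t} | A s t. 0 \<le> s \<and> s < t \<and> t \<le> T \<and> A \<in> sets (F s)} \<union>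
      {A \<times> {0} | A. A \<in> sets (F 0)} \<subseteq> Pow (space M \<times> {0..T})" if "T > 0"
proof -
  have "sets (F s) \<subseteq> sets M" if "s \<in> {0..T}" for s
    using subalgebra_F[OF that] by (simp add: subalgebra_def)
  then have *: "A \<subseteq> space M" if "s \<in> {0..T}" "A \<in> sets (F s)" for s A
    using that sets.sets_into_space by blast
  show ?thesis using * \<open>T > 0\<close> by fastforce
qed

lemma space_predictable:
  assumes "T > 0" shows "space (predictable M F T) = space M \<times> {0..T}"
  unfolding predictable_def using generator_predictable_subset[OF assms] by (rule space_measure_of)

text \<open>Sublevel sets of time are assembled from the generators with first factor
  \<open>space M\<close>, which belongs to every \<open>F s\<close>.\<close>

lemma measurable_snd_predictable:
  assumes "T > 0" shows "snd \<in> borel_measurable (predictable M F T)"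
proof (rule borel_measurableI_le)
  fix a :: real
  have sp: "space M \<in> sets (F s)" if "s \<in> {0..T}" for s
    using subalgebra_F[OF that] sets.top[of "F s"] by (simp add: subalgebra_def)
  have gen: "X \<in> sets (predictable M F T)"
    if "X \<in> {A \<times> {s<..t} | A s t. 0 \<le> s \<and> s < t \<and> t \<le> T \<and> A \<in> sets (F s)} \<union>
      {A \<times> {0} | A. A \<in> sets (F 0)}" for X
    unfolding predictable_def sets_measure_of[OF generator_predictable_subset[OF assms]]
    using that by (rule sigma_sets.Basic)
  have 0: "space M \<times> {0} \<in> sets (predictable M F T)"
    using sp[of 0] assms by (intro gen) auto
  \<comment> \<open>A generating interval must be nondegenerate, so a sublevel set that contains
    only time 0 is treated apart.\<close>
  consider "a < 0" | "a \<ge> 0" "min a T = 0" | "a \<ge> 0" "min a T > 0" using assms by fastforce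
  then show "{x \<in> space (predictable M F T). snd x \<le> a} \<in> sets (predictable M F T)"
  proof cases
    case 1
    then have "{x \<in> space (predictable M F T). snd x \<le> a} = {}"
      by (auto simp: space_predictable[OF assms])
    then show ?thesis by (simp only: sets.empty_sets)
  next
    case 2
    then have "{x \<in> space (predictable M F T). snd x \<le> a} = space M \<times> {0}"
      using assms by (auto simp: space_predictable[OF assms])
    then show ?thesis using 0 by simp
  next
    case 3
    have "space M \<times> {0<..min a T} \<in> sets (predictable M F T)"
      using sp[of 0] 3 assms
      by (intro gen UnI1 CollectI exI[of _ "space M"] exI[of _ "0::real"] exI[of _ "min a T"]) auto
    moreover have "{x \<in> space (predictable M F T). snd x \<le> a} =
        space M \<times> {0} \<union> space M \<times> {0<..min a T}"
      using 3 assms by (auto simp: space_predictable[OF assms])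
    ultimately show ?thesis using 0 by simp
  qed
qed

end

text \<open>A Caratheodory function is jointly measurable: discretise the time variable from above.\<close>

lemma measurable_strongly_continuous_apply:
  fixes R :: "real \<Rightarrow> 'h::{real_normed_vector, second_countable_topology} \<Rightarrow>\<^sub>L 'h"
  assumes R: "strongly_continuous T R"
    and r: "r \<in> borel_measurable N" "\<And>x. x \<in> space N \<Longrightarrow> r x \<le> T"
    and h: "h \<in> borel_measurable N"
  shows "(\<lambda>x. if r x > 0 then R (r x) (h x) else 0) \<in> borel_measurable N"
proof (rule borel_measurable_LIMSEQ_metric)
  \<comment> \<open>The cap at \<open>T\<close> keeps the grid times in the range where
    \<open>R\<close> is known to be continuous.\<close>
  define \<rho> where "\<rho> n i = min T (of_int i / real (Suc n))" for n :: nat and i :: int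
  fix n
  have [measurable]: "(\<lambda>x. R (\<rho> n i) (h x)) \<in> borel_measurable N" for i
    by (rule measurable_compose[OF h]) (intro borel_measurable_continuous_onI continuous_intros)
  \<comment> \<open>The ceiling takes only countably many values, and for each fixed value a bounded
    operator is composed with \<open>h\<close>.\<close>
  have "(\<lambda>x. R (\<rho> n \<lceil>real (Suc n) * r x\<rceil>) (h x)) \<in> borel_measurable N"
    by (rule measurable_compose_countable) (use r in measurable)
  then show "(\<lambda>x. if r x > 0 then R (\<rho> n \<lceil>real (Suc n) * r x\<rceil>) (h x) else 0) \<in> borel_measurable N"
    using r by measurable
next
  fix x assume x: "x \<in> space N"
  show "(\<lambda>n. if r x > 0 then R (min T (of_int \<lceil>real (Suc n) * r x\<rceil> / real (Suc n))) (h x) else 0)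
      \<longlonglongrightarrow> (if r x > 0 then R (r x) (h x) else 0)"
  proof (cases "r x > 0")
    case True
    \<comment> \<open>Rounding up keeps the approximating times strictly positive, where rounding
      down could reach 0.\<close>
    have lo: "r x \<le> of_int \<lceil>real (Suc n) * r x\<rceil> / real (Suc n)" for n
      by (simp add: pos_le_divide_eq mult.commute)
    have hi: "of_int \<lceil>real (Suc n) * r x\<rceil> / real (Suc n) \<le> r x + 1 / real (Suc n)" for n
    proof -
      have "of_int \<lceil>real (Suc n) * r x\<rceil> \<le> real (Suc n) * r x + 1" by linarith
      then have "of_int \<lceil>real (Suc n) * r x\<rceil> / real (Suc n) \<le> (real (Suc n) * r x + 1) / real (Suc n)"
        by (rule divide_right_mono) simp
      then show ?thesis by (simp add: add_divide_distrib)
    qed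
    have "(\<lambda>n. r x + 1 / real (Suc n)) \<longlonglongrightarrow> r x + 0"
      by (intro tendsto_intros LIMSEQ_inverse_real_of_nat[unfolded inverse_eq_divide])
    then have "(\<lambda>n. r x + 1 / real (Suc n)) \<longlonglongrightarrow> r x" by (simp only: add_0_right)
    then have "(\<lambda>n. of_int \<lceil>real (Suc n) * r x\<rceil> / real (Suc n)) \<longlonglongrightarrow> r x"
      by (rule tendsto_sandwich[OF always_eventually[OF allI[OF lo]] always_eventually[OF allI[OF hi]]
            tendsto_const])
    then have "(\<lambda>n. min T (of_int \<lceil>real (Suc n) * r x\<rceil> / real (Suc n))) \<longlonglongrightarrow> min T (r x)"
      by (intro tendsto_intros)
    then have lim: "(\<lambda>n. min T (of_int \<lceil>real (Suc n) * r x\<rceil> / real (Suc n))) \<longlonglongrightarrow> r x"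
      using r(2)[OF x] by (simp add: min_absorb2)
    have "continuous_on {0<..T} (\<lambda>t. R t (h x))" using R by (simp add: strongly_continuous_def)
    from continuous_on_tendsto_compose[OF this lim]
    show ?thesis using True r(2)[OF x] lo by (auto simp: less_le_trans)
  qed simp
qed

text \<open>The sort \<open>{real_inner, polish_space}\<close> encodes separable real Hilbert
  spaces.\<close>

theorem theorem3p10:
  fixes M :: "'w measure" and F :: "real \<Rightarrow> 'w measure" and T :: real
    and R :: "real \<Rightarrow> 'h::{real_inner, polish_space} \<Rightarrow>\<^sub>L 'h"
    and \<Phi> :: "'w \<times> real \<Rightarrow> 'u::{real_inner, polish_space} \<Rightarrow>\<^sub>L 'h"
  assumes "T > 0"
    and "complete_filtered_prob_space M F T"
    and "strongly_continuous T R"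
  shows
    "(strongly_measurable M F T \<Phi> \<and>
      (\<forall>p \<in> (space M \<times> {0..T}) \<times> {0..T}. hilbert_schmidt (conv_map R \<Phi> p)) \<longrightarrow>
      conv_map R \<Phi> \<in>
        measurable (predictable M F T \<Otimes>\<^sub>M restrict_space borel {0..T}) hs_borel)
     \<and>
     ((\<exists>\<tau> :: nat \<Rightarrow> real. (\<forall>n. \<tau> n \<in> {0<..T}) \<and> \<tau> \<longlonglongrightarrow> 0 \<and>
        (\<forall>C u. closed C \<and> convex C \<and> bounded C \<longrightarrow>
          (u \<in> C \<longleftrightarrow>
            (\<exists>k. \<forall>n\<ge>k. blinfun_apply (R (\<tau> n)) u \<in> blinfun_apply (R (\<tau> n)) ` C)))) \<and>
      (\<forall>p \<in> (space M \<times> {0..T}) \<times> {0..T}. hilbert_schmidt (conv_map R \<Phi> p)) \<and>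
      conv_map R \<Phi> \<in>
        measurable (predictable M F T \<Otimes>\<^sub>M restrict_space borel {0..T}) hs_borel \<longrightarrow>
      (\<exists>\<Psi> :: 'w \<times> real \<Rightarrow> 'u \<Rightarrow>\<^sub>L 'h.
        \<exists>A \<in> sets (predictable M F T).
          A \<in> null_sets (M \<Otimes>\<^sub>M restrict_space lborel {0..T}) \<and>
          (\<forall>p \<in> space M \<times> {0..T} - A. \<Phi> p = \<Psi> p) \<and>
          strongly_measurable M F T \<Psi> \<and>
          (\<forall>p \<in> (space M \<times> {0..T}) \<times> {0..T}. hilbert_schmidt (conv_map R \<Psi> p))))"
proof (intro conjI impI)
  interpret complete_filtered_prob_space M F T by fact
  let ?P = "predictable M F T"
  let ?I = "restrict_space borel {0..T} :: real measure"
  note spP = space_predictable[OF \<open>T > 0\<close>]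
  note [measurable] = measurable_snd_predictable[OF \<open>T > 0\<close>]
  have spQ: "space (?P \<Otimes>\<^sub>M ?I) = (space M \<times> {0..T}) \<times> {0..T}"
    by (simp add: space_pair_measure spP)
  have snd_I: "snd \<in> borel_measurable (?P \<Otimes>\<^sub>M ?I)"
    by (rule measurable_compose[OF measurable_snd measurable_restrict_space1]) simp
  {

    \<comment> \<open>From strong measurability to measurability of the convolution\<close>
    assume "strongly_measurable M F T \<Phi> \<and>
      (\<forall>p \<in> (space M \<times> {0..T}) \<times> {0..T}. hilbert_schmidt (conv_map R \<Phi> p))"
    then have sm: "\<And>u. (\<lambda>p. \<Phi> p u) \<in> borel_measurable ?P"
      and hs: "\<And>p. p \<in> (space M \<times> {0..T}) \<times> {0..T} \<Longrightarrow> hilbert_schmidt (conv_map R \<Phi> p)"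
      by (auto simp: strongly_measurable_def)
    show "conv_map R \<Phi> \<in> measurable (?P \<Otimes>\<^sub>M ?I) hs_borel"
    proof (rule measurable_hs_borelI)
      show "hilbert_schmidt (conv_map R \<Phi> p)" if "p \<in> space (?P \<Otimes>\<^sub>M ?I)" for p
        using that by (intro hs) (simp add: spQ)
      fix u
      \<comment> \<open>The condition \<open>t - s > 0\<close> is the indicator of
        \<open>[0,t)\<close> at \<open>s\<close>, because \<open>s\<close> is nonnegative on the
        space.\<close>
      have "(\<lambda>p. if snd p - snd (fst p) > 0 then R (snd p - snd (fst p)) (\<Phi> (fst p) u) else 0)
          \<in> borel_measurable (?P \<Otimes>\<^sub>M ?I)"
        using assms(3)
      proof (rule measurable_strongly_continuous_apply)
        show "(\<lambda>p. snd p - snd (fst p)) \<in> borel_measurable (?P \<Otimes>\<^sub>M ?I)"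
          using snd_I by measurable
        show "(\<lambda>p. \<Phi> (fst p) u) \<in> borel_measurable (?P \<Otimes>\<^sub>M ?I)"
          by (rule measurable_compose[OF measurable_fst sm])
      qed (auto simp: spQ)
      then show "(\<lambda>p. conv_map R \<Phi> p u) \<in> borel_measurable (?P \<Otimes>\<^sub>M ?I)"
        by (rule measurable_cong[THEN iffD1, rotated]) (auto simp: spQ conv_map_def)
    qed
  next

    \<comment> \<open>From measurability of the convolution to a strongly measurable version\<close>
    assume *: "(\<exists>\<tau> :: nat \<Rightarrow> real. (\<forall>n. \<tau> n \<in> {0<..T}) \<and> \<tau> \<longlonglongrightarrow> 0 \<and>
        (\<forall>C u. closed C \<and> convex C \<and> bounded C \<longrightarrow>
          (u \<in> C \<longleftrightarrow>
            (\<exists>k. \<forall>n\<ge>k. blinfun_apply (R (\<tau> n)) u \<in> blinfun_apply (R (\<tau> n)) ` C)))) \<and>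
      (\<forall>p \<in> (space M \<times> {0..T}) \<times> {0..T}. hilbert_schmidt (conv_map R \<Phi> p)) \<and>
      conv_map R \<Phi> \<in> measurable (?P \<Otimes>\<^sub>M ?I) hs_borel"
    then obtain \<tau> :: "nat \<Rightarrow> real"
      where "\<forall>n. \<tau> n \<in> {0<..T}" and \<tau>_lim: "\<tau> \<longlonglongrightarrow> 0"
        and C: "\<forall>C u. closed C \<and> convex C \<and> bounded C \<longrightarrow>
          (u \<in> C \<longleftrightarrow> (\<exists>k. \<forall>n\<ge>k. R (\<tau> n) u \<in> R (\<tau> n) ` C))"
      by (elim conjE exE) (rule that)
    then have \<tau>: "\<tau> n > 0" for n by simp
    have hs: "hilbert_schmidt (conv_map R \<Phi> p)" if "p \<in> (space M \<times> {0..T}) \<times> {0..T}" for p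
      using * that by blast
    have meas: "conv_map R \<Phi> \<in> measurable (?P \<Otimes>\<^sub>M ?I) hs_borel"
      using * by blast
    define A where "A = space M \<times> {T}"
    \<comment> \<open>With the constant value 0 at \<open>s = T\<close>, that slice contributes all
      of \<open>A\<close> or nothing to the preimage of a ball.\<close>
    define \<Psi> where "\<Psi> p = (if snd p = T then 0 else \<Phi> p)" for p
    have A_eq: "A = {p \<in> space ?P. snd p = T}" using \<open>T > 0\<close> by (auto simp: A_def spP)
    have A: "A \<in> sets ?P" unfolding A_eq by measurable
    have null: "A \<in> null_sets (M \<Otimes>\<^sub>M restrict_space lborel {0..T})"
    proof -
      interpret I: sigma_finite_measure "restrict_space lborel {0..T}"
        by (intro sigma_finite_measure_restrict_space sigma_finite_lborel) auto
      have T: "{T} \<in> sets (restrict_space lborel {0..T})"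
        using \<open>T > 0\<close> by (auto simp: sets_restrict_space_iff)
      then have "A \<in> sets (M \<Otimes>\<^sub>M restrict_space lborel {0..T})" unfolding A_def by auto
      moreover have "emeasure (M \<Otimes>\<^sub>M restrict_space lborel {0..T}) A = 0"
        unfolding A_def using T \<open>T > 0\<close>
        by (subst I.emeasure_pair_measure_Times) (auto simp: emeasure_restrict_space)
      ultimately show ?thesis by auto
    qed
    have sm: "strongly_measurable M F T \<Psi>"
      unfolding strongly_measurable_def
    proof (intro allI borel_measurable_cballI)
      fix u c r
      \<comment> \<open>The minimum with \<open>T\<close> keeps the time argument in
        \<open>[0,T]\<close>, so \<open>f n\<close> is measurable on the whole space; its values are
        used only where the minimum has no effect.\<close>
      define f where "f n p = conv_map R \<Phi> (p, min T (snd p + \<tau> n)) u" for n p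
      have f [measurable]: "f n \<in> borel_measurable ?P" for n
      proof -
        have "(\<lambda>p. min T (snd p + \<tau> n)) \<in> measurable ?P ?I"
          using \<open>T > 0\<close> \<tau>[of n] by (intro measurable_restrict_space2) (auto simp: spP intro!: add_nonneg_nonneg less_imp_le)
        then have "(\<lambda>p. (p, min T (snd p + \<tau> n))) \<in> measurable ?P (?P \<Otimes>\<^sub>M ?I)" by simp
        from measurable_compose[OF measurable_compose[OF this meas] measurable_hs_borel_apply]
        show ?thesis unfolding f_def .
      qed
      have f_eq: "f n p = R (\<tau> n) (\<Phi> p u)" if "p \<in> space ?P" "snd p + \<tau> n \<le> T" for n p
        using that \<tau>[of n] by (auto simp: f_def conv_map_def spP)
      \<comment> \<open>Closed images are Borel, which makes the conditions on \<open>f n\<close> in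
        the next set measurable.\<close>
      have cl: "closed (R (\<tau> n) ` cball c r)" for n
        by (intro closed_blinfun_image) auto
      \<comment> \<open>The inequality discards truncated times. Since \<open>\<tau> n > 0\<close>,
        it also excludes \<open>s = T\<close>.\<close>
      let ?G = "{p \<in> space ?P. \<exists>k. \<forall>n\<in>{k..}. snd p + \<tau> n \<le> T \<and> f n p \<in> R (\<tau> n) ` cball c r}"
      have mem: "p \<in> ?G \<longleftrightarrow> snd p \<noteq> T \<and> \<Phi> p u \<in> cball c r" if p: "p \<in> space ?P" for p
      proof
        assume "p \<in> ?G"
        then obtain k where k: "\<And>n. n \<ge> k \<Longrightarrow> snd p + \<tau> n \<le> T \<and> f n p \<in> R (\<tau> n) ` cball c r" by auto
        then have "\<forall>n\<ge>k. R (\<tau> n) (\<Phi> p u) \<in> R (\<tau> n) ` cball c r" using f_eq[OF p] by metis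
        \<comment> \<open>Here the hypothesis on \<open>R\<close> lifts eventual membership in the
          images to membership in the ball.\<close>
        then have "\<Phi> p u \<in> cball c r" by (subst C) auto
        then show "snd p \<noteq> T \<and> \<Phi> p u \<in> cball c r" using k[of k] \<tau>[of k] by auto
      next
        assume *: "snd p \<noteq> T \<and> \<Phi> p u \<in> cball c r"
        then have "T - snd p > 0" using p by (auto simp: spP)
        \<comment> \<open>For \<open>s < T\<close>, convergence of \<open>\<tau>\<close> to 0
          eventually removes the truncation, and membership passes to the images.\<close>
        then have "eventually (\<lambda>n. \<tau> n < T - snd p) sequentially" by (rule order_tendstoD[OF \<tau>_lim])
        then obtain k where k: "\<And>n. n \<ge> k \<Longrightarrow> \<tau> n < T - snd p" by (auto simp: eventually_sequentially)
        have "snd p + \<tau> n \<le> T \<and> f n p \<in> R (\<tau> n) ` cball c r" if "n \<ge> k" for n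
          using f_eq[OF p, of n] k[OF that] * by auto
        then show "p \<in> ?G" using p by auto
      qed
      have "?G \<in> sets ?P"
        using borel_closed[OF cl] by measurable
      moreover have "{p \<in> space ?P. \<Psi> p u \<in> cball c r} = ?G \<union> (if 0 \<in> cball c r then A else {})"
      proof (intro set_eqI)
        fix p
        show "p \<in> {p \<in> space ?P. \<Psi> p u \<in> cball c r} \<longleftrightarrow> p \<in> ?G \<union> (if 0 \<in> cball c r then A else {})"
        proof (cases "p \<in> space ?P")
          case True
          show ?thesis
            using mem[OF True] True unfolding Un_iff by (cases "snd p = T") (auto simp: \<Psi>_def A_eq)
        qed (auto simp: A_eq)
      qed
      ultimately show "{p \<in> space ?P. \<Psi> p u \<in> cball c r} \<in> sets ?P"
        using A by simp
    qed
    \<comment> \<open>At \<open>s = T\<close> the indicator vanishes for every \<open>t\<close> up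
      to \<open>T\<close>, so the change on \<open>A\<close> is invisible in the
      convolution.\<close>
    have "conv_map R \<Psi> p = conv_map R \<Phi> p" if "p \<in> (space M \<times> {0..T}) \<times> {0..T}" for p
      using that by (auto simp: conv_map_def \<Psi>_def)
    then have "\<forall>p \<in> (space M \<times> {0..T}) \<times> {0..T}. hilbert_schmidt (conv_map R \<Psi> p)"
      using hs by simp
    moreover have "\<forall>p \<in> space M \<times> {0..T} - A. \<Phi> p = \<Psi> p" by (auto simp: A_def \<Psi>_def)
    ultimately show "\<exists>\<Psi> :: 'w \<times> real \<Rightarrow> 'u \<Rightarrow>\<^sub>L 'h.
        \<exists>A \<in> sets ?P.
          A \<in> null_sets (M \<Otimes>\<^sub>M restrict_space lborel {0..T}) \<and>
          (\<forall>p \<in> space M \<times> {0..T} - A. \<Phi> p = \<Psi> p) \<and>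
          strongly_measurable M F T \<Psi> \<and>
          (\<forall>p \<in> (space M \<times> {0..T}) \<times> {0..T}. hilbert_schmidt (conv_map R \<Psi> p))"
      using A null sm by blast
  }
qed

end
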